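(* Consider the two-player liquidity provision game described in the context, in the symmetric hyper-saturated limit, i.e. both players use the same architecture and the background liquidity is hyper-saturated ($X\to\infty$, $X\gg L_{sat}$). Assume $N\in(0,1)$ and that $\sigma>0$ or $r_c>0$. In this limit, if the background liquidity also compresses its active exposure proportionally to $N$ (so that $X$ is replaced by $N\cdot X$) when both players adopt the HLCP, then the individual fee share is unchanged: $$\frac{N\cdot W}{N\cdot X+2N\cdot W}=\frac{W}{X+2W}.$$ Consequently, in this stylized limit, the players preserve the same fee share while reducing their active loss-versus-rebalancing exposure by the factor $N$ (from $\mathrm{LVR}_W(T)$ to $N\cdot\mathrm{LVR}_W(T)$) and adding the collateral yield $Y_C(T)$; and the HLCP outcome Pareto-improves on the standard-AMM outcome.
   Context: Two liquidity providers each hold capital $W>0$ over a time horizon $T>0$ (in years). Each uses either a standard automated market maker (standard AMM), in which all of $W$ is active, or the Hybrid Liquidity-Collateral Pool (HLCP), in which only $N\cdot W$ is active and $(1-N)W$ is held as dormant collateral. $X$ is the pre-existing background liquidity in the market pair. $L_{sat}$ is the saturation threshold: the liquidity depth beyond which the marginal reduction in slippage from added liquidity is below a fixed negligible constant, so that aggregate fee revenue is modeled as having plateaued at its upper bound $F_{\max}(T)$ over the horizon. Hyper-saturation means $X\to\infty$ (with $X\gg L_{sat}$). Fees are routed in proportion to active liquidity, so a player's fee payoff is its fraction of total active liquidity (background included) times $F_{\max}(T)$. With volatility $\sigma\ge 0$ and annualized collateral yield rate $r_c\ge 0$, define the cumulative loss-versus-rebalancing (LVR, the adverse selection cost) of active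 capital $W$ and the collateral yield by $$\mathrm{LVR}_W(T):=\frac{\sigma^2}{8}WT,\qquad Y_C(T):=(1-N)W r_c T.$$ When both players use the standard AMM, each one's payoff is $\frac{W}{X+2W}F_{\max}(T)-\mathrm{LVR}_W(T)$. When both use the HLCP and the background is compressed to $N\cdot X$, each one's payoff is $\frac{N\cdot W}{N\cdot X+2N\cdot W}F_{\max}(T)-N\cdot\mathrm{LVR}_W(T)+Y_C(T)$. One outcome Pareto-improves on another if every player receives at least as high a payoff and at least one receives a strictly higher payoff. *)

theory Defs
  imports Complex_Main
begin

datatype player = LP1 | LP2

datatype architecture = Standard_AMM | HLCP

type_synonym profile = "player \<Rightarrow> architecture"

text \<open>\<open>S L\<close> is the slippage at liquidity depth \<open>L\<close>, so the marginal reduction in slippage is the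
  negated derivative; \<open>\<epsilon>\<close> is the constant below which it counts as negligible.\<close>

definition saturation_threshold :: "(real \<Rightarrow> real) \<Rightarrow> real \<Rightarrow> real \<Rightarrow> bool" where
  "saturation_threshold S \<epsilon> L\<^sub>s\<^sub>a\<^sub>t \<longleftrightarrow>
     0 < L\<^sub>s\<^sub>a\<^sub>t \<and> (\<forall>L>L\<^sub>s\<^sub>a\<^sub>t. \<exists>D. (S has_real_derivative D) (at L) \<and> - D < \<epsilon>)"

fun active_capital :: "real \<Rightarrow> real \<Rightarrow> architecture \<Rightarrow> real" where
  "active_capital W N Standard_AMM = W"
| "active_capital W N HLCP = N * W"

text \<open>In the following, \<open>B\<close> is the active background liquidity, which is \<open>X\<close> for an uncompressed
  and \<open>N * X\<close> for a compressed background.\<close>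

definition fee_share :: "real \<Rightarrow> real \<Rightarrow> real \<Rightarrow> profile \<Rightarrow> player \<Rightarrow> real" where
  "fee_share W N B s i =
     active_capital W N (s i) / (B + (active_capital W N (s LP1) + active_capital W N (s LP2)))"

definition LVR :: "real \<Rightarrow> real \<Rightarrow> real \<Rightarrow> real" where
  "LVR \<sigma> A T = \<sigma>\<^sup>2 / 8 * A * T"

definition collateral_yield :: "real \<Rightarrow> real \<Rightarrow> real \<Rightarrow> real \<Rightarrow> real" where
  "collateral_yield N W r\<^sub>c T = (1 - N) * W * r\<^sub>c * T"

definition LVR_exposure :: "real \<Rightarrow> real \<Rightarrow> real \<Rightarrow> real \<Rightarrow> profile \<Rightarrow> player \<Rightarrow> real" where
  "LVR_exposure W N \<sigma> T s i = LVR \<sigma> (active_capital W N (s i)) T"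

fun yield_income :: "real \<Rightarrow> real \<Rightarrow> real \<Rightarrow> real \<Rightarrow> architecture \<Rightarrow> real" where
  "yield_income W N r\<^sub>c T Standard_AMM = 0"
| "yield_income W N r\<^sub>c T HLCP = collateral_yield N W r\<^sub>c T"

text \<open>Aggregate fee revenue has plateaued at \<open>Fmax T\<close>, hence does not depend on the depth.\<close>

definition payoff ::
  "real \<Rightarrow> real \<Rightarrow> real \<Rightarrow> real \<Rightarrow> (real \<Rightarrow> real) \<Rightarrow> real \<Rightarrow> real \<Rightarrow> profile \<Rightarrow> player \<Rightarrow> real" where
  "payoff W N \<sigma> r\<^sub>c Fmax T B s i =
     fee_share W N B s i * Fmax T - LVR_exposure W N \<sigma> T s i + yield_income W N r\<^sub>c T (s i)"

definition pareto_improves :: "(player \<Rightarrow> real) \<Rightarrow> (player \<Rightarrow> real) \<Rightarrow> bool" where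
  "pareto_improves u v \<longleftrightarrow> (\<forall>i. v i \<le> u i) \<and> (\<exists>i. v i < u i)"

abbreviation both_standard :: profile where
  "both_standard \<equiv> \<lambda>_. Standard_AMM"

abbreviation both_HLCP :: profile where
  "both_HLCP \<equiv> \<lambda>_. HLCP"

end

theory Submission imports Defs begin

text \<open>Compressing the background along with both players scales every term of the share by
  \<open>N\<close>, so the factor cancels (\<open>compressed_share_eq\<close>) and fee income is the
  same in both outcomes. LVR is linear in active capital, so it shrinks by the factor
  \<open>N\<close>. The payoff difference is therefore \<open>(1 - N) * LVR \<sigma> W T\<close>
  plus the collateral yield, that is
  \<open>(1 - N) * W * T * (\<sigma>\<^sup>2 / 8 + r\<^sub>c)\<close>, which is positive
  (\<open>HLCP_gain\<close>). This gap depends neither on \<open>X\<close> nor on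
  \<open>Fmax\<close>. Hence the strict inequality, which a limit could in general weaken, survives
  \<open>X\<close> tending to infinity, where the fee income itself vanishes
  (\<open>share_tendsto_0\<close>).\<close>

lemma fee_share_both_standard: "fee_share W N X both_standard i = W / (X + 2 * W)"
  by (simp add: fee_share_def)

lemma fee_share_both_HLCP: "fee_share W N B both_HLCP i = N * W / (B + 2 * N * W)"
  by (simp add: fee_share_def)

text \<open>\<open>N\<close> factors out of the denominator and cancels. If
  \<open>X + 2 * W = 0\<close>, both sides are 0 by the convention for division by zero.\<close>

lemma compressed_share_eq:
  fixes N W X :: real
  assumes "N \<noteq> 0"
  shows "N * W / (N * X + 2 * N * W) = W / (X + 2 * W)"
proof -
  have "N * X + 2 * N * W = N * (X + 2 * W)"
    by (simp add: algebra_simps)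
  then show ?thesis
    using assms by simp
qed

lemma LVR_exposure_both_standard: "LVR_exposure W N \<sigma> T both_standard i = LVR \<sigma> W T"
  by (simp add: LVR_exposure_def)

lemma LVR_exposure_both_HLCP: "LVR_exposure W N \<sigma> T both_HLCP i = N * LVR \<sigma> W T"
  by (simp add: LVR_exposure_def LVR_def)

lemma payoff_both_standard:
  "payoff W N \<sigma> r\<^sub>c Fmax T X both_standard i = W / (X + 2 * W) * Fmax T - LVR \<sigma> W T"
  by (simp add: payoff_def fee_share_both_standard LVR_exposure_both_standard)

lemma payoff_both_HLCP:
  assumes "N \<noteq> 0"
  shows "payoff W N \<sigma> r\<^sub>c Fmax T (N * X) both_HLCP i
    = W / (X + 2 * W) * Fmax T - N * LVR \<sigma> W T + collateral_yield N W r\<^sub>c T"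
  using assms
  by (simp add: payoff_def fee_share_both_HLCP LVR_exposure_both_HLCP compressed_share_eq)

text \<open>The right side minus the left side factors as
  \<open>(1 - N) * W * T * (\<sigma>\<^sup>2 / 8 + r\<^sub>c)\<close>. The last factor is positive
  because one of its nonnegative summands is strictly positive.\<close>

lemma HLCP_gain:
  assumes "0 < W" and "0 < T" and "N < 1"
    and "0 \<le> r\<^sub>c" and "\<sigma> \<noteq> 0 \<or> 0 < r\<^sub>c"
  shows "- LVR \<sigma> W T < - (N * LVR \<sigma> W T) + collateral_yield N W r\<^sub>c T"
proof -
  have "0 < \<sigma>\<^sup>2 / 8 + r\<^sub>c"
    using assms by (auto intro: add_pos_nonneg add_nonneg_pos)
  then have "0 < (1 - N) * W * T * (\<sigma>\<^sup>2 / 8 + r\<^sub>c)"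
    using assms by simp
  then show ?thesis
    by (simp add: LVR_def collateral_yield_def algebra_simps diff_divide_distrib)
qed

lemma pareto_improvesI:
  assumes "\<And>i. v i < u i"
  shows "pareto_improves u v"
  using assms by (auto simp: pareto_improves_def intro: less_imp_le)

lemma share_tendsto_0: "((\<lambda>X::real. W / (X + 2 * W)) \<longlongrightarrow> 0) at_top"
proof (rule tendsto_divide_0[OF tendsto_const])
  show "filterlim (\<lambda>X. X + 2 * W) at_infinity at_top"
    \<comment> \<open>The swap puts the constant summand first, as
      \<open>filterlim_tendsto_add_at_top\<close> expects.\<close>
    by (rule filterlim_at_top_imp_at_infinity, subst add.commute,
        rule filterlim_tendsto_add_at_top[OF tendsto_const filterlim_ident])
qed

theorem corollary14:
  fixes W T N \<sigma> r\<^sub>c \<epsilon> L\<^sub>s\<^sub>a\<^sub>t :: real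
    and slippage Fmax :: "real \<Rightarrow> real"
  assumes "0 < W" and "0 < T"
    and "0 < N" and "N < 1"
    and "0 \<le> \<sigma>" and "0 \<le> r\<^sub>c" and "0 < \<sigma> \<or> 0 < r\<^sub>c"
    and "0 < \<epsilon>" and "saturation_threshold slippage \<epsilon> L\<^sub>s\<^sub>a\<^sub>t"
  shows
    "(\<forall>X>L\<^sub>s\<^sub>a\<^sub>t.
        (\<forall>i. fee_share W N X both_standard i = W / (X + 2 * W)
           \<and> fee_share W N (N * X) both_HLCP i = N * W / (N * X + 2 * N * W)
           \<and> N * W / (N * X + 2 * N * W) = W / (X + 2 * W)
           \<and> LVR_exposure W N \<sigma> T both_standard i = LVR \<sigma> W T
           \<and> LVR_exposure W N \<sigma> T both_HLCP i = N * LVR \<sigma> W T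
           \<and> payoff W N \<sigma> r\<^sub>c Fmax T X both_standard i
               = W / (X + 2 * W) * Fmax T - LVR \<sigma> W T
           \<and> payoff W N \<sigma> r\<^sub>c Fmax T (N * X) both_HLCP i
               = W / (X + 2 * W) * Fmax T - N * LVR \<sigma> W T + collateral_yield N W r\<^sub>c T)
        \<and> pareto_improves (payoff W N \<sigma> r\<^sub>c Fmax T (N * X) both_HLCP)
                          (payoff W N \<sigma> r\<^sub>c Fmax T X both_standard))
     \<and> (\<exists>u\<^sub>A u\<^sub>H.
          (\<forall>i. ((\<lambda>X. payoff W N \<sigma> r\<^sub>c Fmax T X both_standard i) \<longlongrightarrow> u\<^sub>A i) at_top)
        \<and> (\<forall>i. ((\<lambda>X. payoff W N \<sigma> r\<^sub>c Fmax T (N * X) both_HLCP i) \<longlongrightarrow> u\<^sub>H i) at_top)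
        \<and> pareto_improves u\<^sub>H u\<^sub>A)"
proof (intro conjI exI allI impI)
  have N: "N \<noteq> 0"
    using assms by simp
  have gain: "- LVR \<sigma> W T < - (N * LVR \<sigma> W T) + collateral_yield N W r\<^sub>c T"
    using assms by (intro HLCP_gain) auto
  \<comment> \<open>\<open>Fmax T\<close> is a constant in \<open>X\<close>, so a vanishing share
    means vanishing fee income.\<close>
  have fees: "((\<lambda>X. W / (X + 2 * W) * Fmax T) \<longlongrightarrow> 0) at_top"
    by (rule tendsto_mult_left_zero[OF share_tendsto_0])
  note payoffs = payoff_both_standard payoff_both_HLCP[OF N]
  fix X :: real and i :: player
  show "fee_share W N X both_standard i = W / (X + 2 * W)"
    by (rule fee_share_both_standard)
  show "fee_share W N (N * X) both_HLCP i = N * W / (N * X + 2 * N * W)"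
    by (rule fee_share_both_HLCP)
  show "N * W / (N * X + 2 * N * W) = W / (X + 2 * W)"
    using N by (rule compressed_share_eq)
  show "LVR_exposure W N \<sigma> T both_standard i = LVR \<sigma> W T"
    by (rule LVR_exposure_both_standard)
  show "LVR_exposure W N \<sigma> T both_HLCP i = N * LVR \<sigma> W T"
    by (rule LVR_exposure_both_HLCP)
  show "payoff W N \<sigma> r\<^sub>c Fmax T X both_standard i = W / (X + 2 * W) * Fmax T - LVR \<sigma> W T"
    by (rule payoffs)
  show "payoff W N \<sigma> r\<^sub>c Fmax T (N * X) both_HLCP i
      = W / (X + 2 * W) * Fmax T - N * LVR \<sigma> W T + collateral_yield N W r\<^sub>c T"
    by (rule payoffs)
  show "pareto_improves (payoff W N \<sigma> r\<^sub>c Fmax T (N * X) both_HLCP)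
      (payoff W N \<sigma> r\<^sub>c Fmax T X both_standard)"
    \<comment> \<open>The fee term is common to both payoffs and cancels, leaving exactly
      \<open>gain\<close>, for either player.\<close>
    using gain by (intro pareto_improvesI) (simp add: payoffs)
  \<comment> \<open>This and the next \<open>show\<close> fix the witnesses for
    \<open>u\<^sub>A\<close> and \<open>u\<^sub>H\<close>, the same for both players. The leading 0
    is the limit of the fee term, left unsimplified to match the form given by
    \<open>tendsto_intros\<close>.\<close>
  show "((\<lambda>X. payoff W N \<sigma> r\<^sub>c Fmax T X both_standard i) \<longlongrightarrow> 0 - LVR \<sigma> W T) at_top"
    unfolding payoffs by (intro tendsto_intros fees)
  show "((\<lambda>X. payoff W N \<sigma> r\<^sub>c Fmax T (N * X) both_HLCP i)
      \<longlongrightarrow> 0 - N * LVR \<sigma> W T + collateral_yield N W r\<^sub>c T) at_top"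
    unfolding payoffs by (intro tendsto_intros fees)
  show "pareto_improves (\<lambda>_. 0 - N * LVR \<sigma> W T + collateral_yield N W r\<^sub>c T)
      (\<lambda>_. 0 - LVR \<sigma> W T)"
    using gain by (intro pareto_improvesI) simp
qed

end
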